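(* Let $\mathbb{F}$ be an arbitrary field and let $V$ be an infinite-dimensional vector space over $\mathbb{F}$. Let $u$ be a finite-rank endomorphism of $V$, and let $\alpha \in \mathbb{F}$. Then $f:=\alpha\,\mathrm{id}_V+u$ is a linear combination of three idempotent endomorphisms of $V$, i.e. there exist scalars $\lambda_1,\lambda_2,\lambda_3 \in \mathbb{F}$ and idempotent endomorphisms $p_1,p_2,p_3$ of $V$ such that $f=\lambda_1 p_1+\lambda_2 p_2+\lambda_3 p_3$.
   Context: An endomorphism $p$ of $V$ is idempotent if $p \circ p=p$. *)

theory Defs
  imports Complex_Main
begin

text \<open>
  The vector space is the whole type \<open>'b\<close>, over a field type \<open>'a\<close>, with scalar multiplication
  \<open>scale\<close>. The library constant \<open>dim\<close> is a natural number that is \<open>0\<close> whenever there is no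
  finite basis, so it cannot tell infinite dimension apart from dimension zero;
  finite-dimensionality is therefore stated as the existence of a finite basis.
\<close>

definition finite_dim_subspace ::
    "('a::field \<Rightarrow> 'b::ab_group_add \<Rightarrow> 'b) \<Rightarrow> 'b set \<Rightarrow> bool" where
  "finite_dim_subspace scale S \<longleftrightarrow>
     (\<exists>B. finite B \<and> \<not> module.dependent scale B \<and> module.span scale B = S)"

definition infinite_dimensional ::
    "('a::field \<Rightarrow> 'b::ab_group_add \<Rightarrow> 'b) \<Rightarrow> bool" where
  "infinite_dimensional scale \<longleftrightarrow> \<not> finite_dim_subspace scale UNIV"

definition endomorphism ::
    "('a::field \<Rightarrow> 'b::ab_group_add \<Rightarrow> 'b) \<Rightarrow> ('b \<Rightarrow> 'b) \<Rightarrow> bool" where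
  "endomorphism scale f \<longleftrightarrow> Vector_Spaces.linear scale scale f"

definition finite_rank ::
    "('a::field \<Rightarrow> 'b::ab_group_add \<Rightarrow> 'b) \<Rightarrow> ('b \<Rightarrow> 'b) \<Rightarrow> bool" where
  "finite_rank scale f \<longleftrightarrow> finite_dim_subspace scale (range f)"

definition idempotent_endomorphism ::
    "('a::field \<Rightarrow> 'b::ab_group_add \<Rightarrow> 'b) \<Rightarrow> ('b \<Rightarrow> 'b) \<Rightarrow> bool" where
  "idempotent_endomorphism scale p \<longleftrightarrow> endomorphism scale p \<and> p \<circ> p = p"

end

theory Submission
  imports Defs
begin

text \<open>
  An operator of block form \<open>((a + b, X), (Z, 0))\<close> with \<open>a\<close> and \<open>b\<close> nonzero is \<open>a p + b q\<close> with idempotents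
  \<open>p\<close> and \<open>q\<close>, whatever \<open>X\<close> and \<open>Z\<close> are (\<open>three_idempotents_if_block_form\<close>). So the task is to subtract from \<open>u\<close> a
  multiple \<open>c r\<close> of an idempotent such that the diagonal blocks of the rest become \<open>a + b\<close> and \<open>0\<close>. The
  coefficient \<open>a\<close> stays prescribed throughout: for \<open>\<alpha> \<noteq> 0\<close> one takes \<open>a = - \<alpha>\<close>, and the scalar part
  is then absorbed by replacing \<open>p\<close> with \<open>id - p\<close>.

  The space has a basis of Krylov chains of \<open>u\<close> and of kernel vectors (\<open>parity_basis_exists\<close>). Every
  chain \<open>x, u x, u (u x), \<dots>\<close> runs until it becomes dependent on its own vectors and the earlier chains. Label the
  last vector of each chain odd and alternate the labels backwards along the chain. Then \<open>u\<close> exchanges odd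
  and even vectors, except for what it does to the last vectors \<open>e 0, \<dots>, e (l - 1)\<close>, and the block of \<open>u\<close>
  on their span \<open>K\<close> is triangular. Infinite dimension enters here: adding a generic kernel vector to
  the start of a chain gives each chain a length of at least two, so that each \<open>e i\<close> has an even partner
  which \<open>u\<close> maps to it.

  The diagonal of the triangular block has the wrong entries, and only its sum can be prescribed by choosing
  \<open>c\<close>. A triangular matrix of trace zero is a commutator \<open>J U - U J\<close> with the shift \<open>J\<close> over every field
  (\<open>commutator_upper_triangular\<close>). So the block on \<open>K\<close> is \<open>c + J U - U J\<close> if the trace is right. A shear towards
  the partners moves \<open>J U\<close> into the even block (\<open>shear_blocks\<close>); the remaining odd block \<open>c - U J\<close> and the new
  even block, which is a copy of \<open>J U\<close>, are the diagonal blocks of \<open>c\<close> times an idempotent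
  (\<open>three_idempotents_if_scalar_plus_commutator\<close>).

  The trace equals \<open>l c\<close> for some \<open>c \<noteq> 0\<close> unless it or \<open>l\<close> vanishes in the field. A variant with
  \<open>l + 1\<close> in place of \<open>l\<close> settles the case that the trace is nonzero, and also trace zero in characteristic two.
  For trace zero in all other characteristics, a nonzero \<open>a + b\<close> is used
  (\<open>three_idempotents_if_commutator\<close>).
\<close>

section \<open>Endomorphisms and sums of idempotents\<close>

locale endomorphism_space = vector_space scale
  for scale :: "'a::field \<Rightarrow> 'b::ab_group_add \<Rightarrow> 'b"
begin

abbreviation endo :: "('b \<Rightarrow> 'b) \<Rightarrow> bool" where
  "endo \<equiv> endomorphism scale"

lemma endoI:
  assumes "\<And>x y. f (x + y) = f x + f y" and "\<And>c x. f (scale c x) = scale c (f x)"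
  shows "endo f"
  using assms vector_space_axioms unfolding endomorphism_def Vector_Spaces.linear_iff by simp

lemma endo_add: "endo f \<Longrightarrow> f (x + y) = f x + f y"
  and endo_scale: "endo f \<Longrightarrow> f (scale c x) = scale c (f x)"
  unfolding endomorphism_def Vector_Spaces.linear_iff by auto

lemma endo_zero: "endo f \<Longrightarrow> f 0 = 0"
  using endo_scale[of f 0 0] by simp

lemma endo_uminus: "endo f \<Longrightarrow> f (- x) = - f x"
  using endo_scale[of f "-1" x] by simp

lemma endo_diff: "endo f \<Longrightarrow> f (x - y) = f x - f y"
  using endo_add[of f x "- y"] by (simp add: endo_uminus)

lemmas endo_simps = endo_add endo_diff endo_scale endo_zero endo_uminus

definition three_idempotents :: "'a \<Rightarrow> 'a \<Rightarrow> 'a \<Rightarrow> ('b \<Rightarrow> 'b) \<Rightarrow> bool" where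
  "three_idempotents a b c f \<longleftrightarrow> (\<exists>p q r. idempotent_endomorphism scale p \<and>
     idempotent_endomorphism scale q \<and> idempotent_endomorphism scale r \<and>
     (\<forall>x. f x = scale a (p x) + scale b (q x) + scale c (r x)))"

lemma idempotent_endomorphismI:
  "endo p \<Longrightarrow> (\<And>x. p (p x) = p x) \<Longrightarrow> idempotent_endomorphism scale p"
  unfolding idempotent_endomorphism_def by (auto simp: fun_eq_iff)

lemma three_idempotents_conjugate:
  assumes "endo g" "endo h" "\<And>x. g (h x) = x" "\<And>x. h (g x) = x"
    and "three_idempotents a b c (\<lambda>x. g (f (h x)))"
  shows "three_idempotents a b c f"
proof -
  obtain p q r where idem: "idempotent_endomorphism scale p" "idempotent_endomorphism scale q"
      "idempotent_endomorphism scale r"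
    and eq: "\<And>x. g (f (h x)) = scale a (p x) + scale b (q x) + scale c (r x)"
    using assms(5) unfolding three_idempotents_def by blast
  have conj: "idempotent_endomorphism scale (\<lambda>x. h (s (g x)))"
    if "idempotent_endomorphism scale s" for s
  proof -
    have s: "endo s" "\<And>x. s (s x) = s x"
      using that unfolding idempotent_endomorphism_def by (auto simp: fun_eq_iff)
    show ?thesis
      by (rule idempotent_endomorphismI, rule endoI) (use s assms in \<open>simp_all add: endo_simps\<close>)
  qed
  have "f x = scale a (h (p (g x))) + scale b (h (q (g x))) + scale c (h (r (g x)))" for x
  proof -
    have "f x = h (g (f (h (g x))))" using assms by simp
    also have "\<dots> = h (scale a (p (g x)) + scale b (q (g x)) + scale c (r (g x)))" by (simp only: eq)
    finally show ?thesis using assms(2) by (simp add: endo_simps)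
  qed
  then show ?thesis
    unfolding three_idempotents_def using conj idem by blast
qed

text \<open>
  Relative to the decomposition of the space into the range and the kernel of \<open>\<pi>\<close>, the map \<open>w\<close> has
  the block form \<open>((a + b, X), (Z, 0))\<close>. It is the sum of \<open>((a, X), (0, 0))\<close> and \<open>((b, 0), (Z, 0))\<close>,
  and these are multiples of idempotents by \<open>a\<close> and \<open>b\<close> no matter what \<open>X\<close> and \<open>Z\<close> are.
\<close>

lemma three_idempotents_if_block_form:
  assumes lin: "endo \<pi>" "endo w" and idem: "\<And>x. \<pi> (\<pi> x) = \<pi> x"
    and r: "idempotent_endomorphism scale r"
    and diag1: "\<And>x. \<pi> (w (\<pi> x)) = scale (a + b) (\<pi> x)"
    and diag2: "\<And>x. w (x - \<pi> x) = \<pi> (w (x - \<pi> x))"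
    and nz: "a \<noteq> 0" "b \<noteq> 0"
    and f: "\<And>x. f x = w x + scale c (r x)"
  shows "three_idempotents a b c f"
proof -
  define p where "p x = \<pi> x + scale (1 / a) (w (x - \<pi> x))" for x
  define q where "q x = \<pi> x + scale (1 / b) (w (\<pi> x) - \<pi> (w (\<pi> x)))" for x
  have [simp]: "\<pi> (w (x - \<pi> x)) = w (x - \<pi> x)" for x
    using diag2 by simp
  have p: "idempotent_endomorphism scale p"
  proof (intro idempotent_endomorphismI endoI)
    show "p (x + y) = p x + p y" "p (scale k x) = scale k (p x)" for x y k
      using lin by (simp_all add: p_def endo_simps algebra_simps)
    have "\<pi> (p x) = p x" for x
      using lin idem by (simp add: p_def endo_add endo_scale)
    then show "p (p x) = p x" for x
      using lin by (simp add: p_def[of "p x"] endo_zero)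
  qed
  have q: "idempotent_endomorphism scale q"
  proof (intro idempotent_endomorphismI endoI)
    show "q (x + y) = q x + q y" "q (scale k x) = scale k (q x)" for x y k
      using lin by (simp_all add: q_def endo_simps algebra_simps)
    have "\<pi> (q x) = \<pi> x" for x
      using lin idem by (simp add: q_def endo_simps)
    then show "q (q x) = q x" for x
      by (simp add: q_def)
  qed
  have "w x = scale a (p x) + scale b (q x)" for x
  proof -
    have "w x = w (\<pi> x) + w (x - \<pi> x)"
      using lin endo_add[of w "\<pi> x" "x - \<pi> x"] by simp
    also have "\<dots> = scale (a + b) (\<pi> x) + (w (\<pi> x) - \<pi> (w (\<pi> x))) + w (x - \<pi> x)"
      by (simp add: diag1)
    finally show ?thesis
      using nz by (simp add: p_def q_def scale_right_distrib scale_left_distrib)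
  qed
  then show ?thesis
    unfolding three_idempotents_def using p q r f by auto
qed

end

section \<open>Operators that almost exchange two complementary subspaces\<close>

text \<open>
  The range of \<open>\<pi>\<close> is the odd part of the space and the kernel of \<open>\<pi>\<close> its even part. The map \<open>u\<close>
  exchanges the two parts, except on the odd subspace \<open>K\<close> onto which \<open>\<kappa>\<close> projects, where it is
  unrestricted. The map \<open>\<sigma>\<close> provides for every vector of \<open>K\<close> an even preimage under \<open>u\<close>; these
  partners are the room that is needed to redistribute the diagonal of the block of \<open>u\<close> on \<open>K\<close>.
\<close>

locale parity_splitting = endomorphism_space scale
  for scale :: "'a::field \<Rightarrow> 'b::ab_group_add \<Rightarrow> 'b" +
  fixes u \<pi> \<kappa> \<sigma> :: "'b \<Rightarrow> 'b"
  assumes lin_u: "endomorphism scale u" and lin_\<pi>: "endomorphism scale \<pi>"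
    and lin_\<kappa>: "endomorphism scale \<kappa>" and lin_\<sigma>: "endomorphism scale \<sigma>"
    and \<pi>\<pi>: "\<pi> (\<pi> x) = \<pi> x" and \<kappa>\<kappa>: "\<kappa> (\<kappa> x) = \<kappa> x"
    and \<pi>\<kappa>: "\<pi> (\<kappa> x) = \<kappa> x" and \<kappa>\<pi>: "\<kappa> (\<pi> x) = \<kappa> x"
    and \<pi>\<sigma>: "\<pi> (\<sigma> x) = 0" and \<sigma>\<kappa>: "\<sigma> (\<kappa> x) = \<sigma> x" and u\<sigma>: "u (\<sigma> x) = \<kappa> x"
    and even_to_odd: "\<pi> (u (x - \<pi> x)) = u (x - \<pi> x)"
    and odd_to_even: "\<pi> (u (\<pi> x - \<kappa> x)) = 0"
begin

text \<open>
  On the even part, \<open>\<tau>\<close> is the \<open>K\<close>-component of \<open>u\<close>, and there it is a left inverse of \<open>\<sigma>\<close> on \<open>K\<close>.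
  The odd component of \<open>u\<close> on \<open>K\<close> consists of the block on \<open>K\<close> and of \<open>b\<close>, which leads out of \<open>K\<close>.
\<close>

definition \<tau> :: "'b \<Rightarrow> 'b" where "\<tau> x = \<kappa> (u (x - \<pi> x))"
definition b :: "'b \<Rightarrow> 'b" where "b x = \<pi> (u (\<kappa> x)) - \<kappa> (u (\<kappa> x))"

lemma lin_\<tau>: "endo \<tau>" and lin_b: "endo b"
  by (rule endoI; simp add: \<tau>_def b_def endo_simps lin_u lin_\<pi> lin_\<kappa> algebra_simps)+

lemma \<kappa>\<sigma>: "\<kappa> (\<sigma> x) = 0"
  by (metis \<kappa>\<pi> \<pi>\<sigma> endo_zero lin_\<kappa>)

lemma \<tau>\<sigma>: "\<tau> (\<sigma> x) = \<kappa> x"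
  by (simp add: \<tau>_def \<pi>\<sigma> u\<sigma> \<kappa>\<kappa>)
lemma \<tau>\<pi>: "\<tau> (\<pi> x) = 0" and \<tau>\<kappa>: "\<tau> (\<kappa> x) = 0"
  by (simp_all add: \<tau>_def \<pi>\<pi> \<pi>\<kappa> \<kappa>\<kappa> endo_zero lin_u lin_\<kappa>)
lemma \<kappa>b: "\<kappa> (b x) = 0" and \<pi>b: "\<pi> (b x) = b x" and b\<kappa>: "b (\<kappa> x) = b x" and b\<pi>: "b (\<pi> x) = b x"
  by (simp_all add: b_def \<kappa>\<pi> \<kappa>\<kappa> \<pi>\<pi> \<pi>\<kappa> endo_simps lin_\<pi> lin_\<kappa>)

lemma \<tau>b: "\<tau> (b x) = 0"
  by (metis \<pi>b \<tau>\<pi>)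

lemmas words = \<pi>\<pi> \<kappa>\<kappa> \<pi>\<kappa> \<kappa>\<pi> \<pi>\<sigma> \<sigma>\<kappa> u\<sigma> \<kappa>\<sigma> \<tau>\<sigma> \<tau>\<pi> \<tau>\<kappa> \<kappa>b \<pi>b b\<kappa> b\<pi> \<tau>b

lemma \<pi>u\<pi>: "\<pi> (u (\<pi> x)) = \<kappa> (u (\<kappa> x)) + b x"
  using odd_to_even[of x] by (simp add: b_def endo_simps lin_u lin_\<pi>)

text \<open>
  The map \<open>v\<close> is the conjugate of \<open>u\<close> by the shear \<open>1 + \<sigma> \<theta>\<close>. The conjugation takes \<open>\<theta>\<close> away from
  the odd diagonal block and puts \<open>\<sigma> \<theta> \<tau>\<close> into the even diagonal block, which was zero: a part of the
  diagonal moves from \<open>K\<close> to its partners.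
\<close>

lemma shear_blocks:
  assumes \<theta>: "endo \<theta>" "\<And>x. \<theta> (\<kappa> x) = \<theta> x"
    and \<theta>k: "\<And>x. \<kappa> (\<theta> x) = \<theta> x"
    and v: "\<And>x. v x = u (x - \<sigma> (\<theta> x)) + \<sigma> (\<theta> (u (x - \<sigma> (\<theta> x))))"
  shows "endo v" "\<pi> (v (\<pi> x)) = \<kappa> (u (\<kappa> x)) + b x - \<theta> x"
    "v (x - \<pi> x) - \<pi> (v (x - \<pi> x)) = \<sigma> (\<theta> (\<tau> x))"
    "three_idempotents k l m v \<Longrightarrow> three_idempotents k l m u"
proof -
  note lin = lin_u lin_\<pi> lin_\<sigma> lin_\<kappa> \<theta>(1)
  have \<theta>\<pi>: "\<theta> (\<pi> x) = \<theta> x" for x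
    by (metis \<theta>(2) \<kappa>\<pi>)
  have \<theta>\<sigma>: "\<theta> (\<sigma> x) = 0" for x
    by (metis \<theta>(2) \<kappa>\<sigma> endo_zero \<theta>(1))
  have u\<sigma>\<theta>: "u (\<sigma> (\<theta> x)) = \<theta> x" for x
    by (simp add: u\<sigma> \<theta>k)
  show "endo v"
    by (rule endoI) (simp_all add: v endo_simps lin algebra_simps)
  show "\<pi> (v (\<pi> x)) = \<kappa> (u (\<kappa> x)) + b x - \<theta> x"
    using \<pi>u\<pi>[of x] by (simp add: v endo_simps lin words \<theta>\<pi> u\<sigma>\<theta>) (metis \<pi>\<kappa> \<theta>k)
  have "\<sigma> (\<theta> (x - \<pi> x)) = 0"
    using lin by (simp add: endo_simps \<theta>\<pi>)
  then have "v (x - \<pi> x) = u (x - \<pi> x) + \<sigma> (\<theta> (u (x - \<pi> x)))"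
    by (simp add: v)
  moreover have "\<theta> (u (x - \<pi> x)) = \<theta> (\<tau> x)"
    by (simp add: \<tau>_def \<theta>)
  moreover have "\<pi> (u (x - \<pi> x) + \<sigma> y) = u (x - \<pi> x)" for y
    by (simp only: endo_add[OF lin_\<pi>] even_to_odd \<pi>\<sigma> add_0_right)
  ultimately show "v (x - \<pi> x) - \<pi> (v (x - \<pi> x)) = \<sigma> (\<theta> (\<tau> x))"
    by simp
  have gen: "endo (\<lambda>x. x + \<sigma> (\<theta> x))" "endo (\<lambda>x. x - \<sigma> (\<theta> x))"
    by (rule endoI; simp add: endo_simps lin algebra_simps)+
  show "three_idempotents k l m u" if "three_idempotents k l m v"
    by (rule three_idempotents_conjugate[OF gen])
      (use that in \<open>simp_all add: endo_simps lin \<theta>\<sigma> v[abs_def]\<close>)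
qed


text \<open>
  Suppose that the block of \<open>u\<close> on \<open>K\<close> is \<open>c + J U - U J + c \<rho>\<close> with a further idempotent \<open>\<rho>\<close>. The shear
  with \<open>\<theta> = J U + c \<rho>\<close> leaves the odd block \<open>c - U J + b\<close> and creates the even block \<open>\<sigma> (J U + c \<rho>) \<tau>\<close>.
  These are the diagonal blocks of \<open>F G + c \<sigma> \<rho> \<tau>\<close>, where \<open>G F = c \<kappa>\<close>, so that \<open>F G / c\<close> is idempotent:
  the products \<open>U J\<close> and \<open>J U\<close> in the two blocks are what lets \<open>G F\<close> collapse to \<open>c\<close>. The conditions on
  \<open>\<rho>\<close> make the idempotents \<open>F G / c\<close> and \<open>\<sigma> \<rho> \<tau>\<close> orthogonal. What remains after subtracting \<open>c\<close>
  times their sum exchanges the odd and the even part.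
\<close>

lemma three_idempotents_if_scalar_plus_commutator:
  assumes lin: "endo J" "endo U" "endo \<rho>"
    and J: "\<And>x. \<kappa> (J x) = J x" "\<And>x. J (\<kappa> x) = J x"
    and U: "\<And>x. \<kappa> (U x) = U x" "\<And>x. U (\<kappa> x) = U x"
    and \<rho>: "\<And>x. \<kappa> (\<rho> x) = \<rho> x" "\<And>x. \<rho> (\<kappa> x) = \<rho> x" "\<And>x. \<rho> (\<rho> x) = \<rho> x"
    and \<rho>J: "\<And>x. \<rho> (J x) = 0" and U\<rho>: "\<And>x. U (\<rho> x) = 0"
    and block: "\<And>x. \<kappa> (u (\<kappa> x)) = scale c (\<kappa> x) + J (U x) - U (J x) + scale c (\<rho> x)"
    and nz: "c \<noteq> 0" "a \<noteq> 0"
  shows "three_idempotents a (- a) c u"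
proof -
  define \<theta> where "\<theta> x = J (U x) + scale c (\<rho> x)" for x
  define v where "v x = u (x - \<sigma> (\<theta> x)) + \<sigma> (\<theta> (u (x - \<sigma> (\<theta> x))))" for x
  define F where "F x = scale c (\<kappa> x) - U (J x) + b x + \<sigma> (J x)" for x
  define G where "G x = \<kappa> x + U (\<tau> x)" for x
  define r where "r x = scale (1 / c) (F (G x)) + \<sigma> (\<rho> (\<tau> x))" for x
  note lin = lin lin_u lin_\<pi> lin_\<sigma> lin_\<kappa> lin_\<tau> lin_b
  have \<pi>J: "\<pi> (J x) = J x" and \<pi>U: "\<pi> (U x) = U x" and \<pi>\<rho>: "\<pi> (\<rho> x) = \<rho> x" for x
    by (metis J(1) \<pi>\<kappa>, metis U(1) \<pi>\<kappa>, metis \<rho>(1) \<pi>\<kappa>)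
  have J\<pi>: "J (\<pi> x) = J x" and U\<pi>: "U (\<pi> x) = U x" and \<rho>\<pi>: "\<rho> (\<pi> x) = \<rho> x" for x
    by (metis J(2) \<kappa>\<pi>, metis U(2) \<kappa>\<pi>, metis \<rho>(2) \<kappa>\<pi>)
  have Jb: "J (b x) = 0" and Ub: "U (b x) = 0" and \<rho>b: "\<rho> (b x) = 0" for x
    by (metis J(2) \<kappa>b endo_zero lin, metis U(2) \<kappa>b endo_zero lin, metis \<rho>(2) \<kappa>b endo_zero lin)
  have J\<sigma>: "J (\<sigma> x) = 0" and U\<sigma>: "U (\<sigma> x) = 0" and \<rho>\<sigma>: "\<rho> (\<sigma> x) = 0" for x
    by (metis J(2) \<kappa>\<sigma> endo_zero lin, metis U(2) \<kappa>\<sigma> endo_zero lin, metis \<rho>(2) \<kappa>\<sigma> endo_zero lin)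
  have \<tau>J: "\<tau> (J x) = 0" and \<tau>U: "\<tau> (U x) = 0" and \<tau>\<rho>: "\<tau> (\<rho> x) = 0" for x
    by (metis \<tau>\<pi> \<pi>J, metis \<tau>\<pi> \<pi>U, metis \<tau>\<pi> \<pi>\<rho>)
  note words = words J U \<rho> \<rho>J U\<rho> \<pi>J \<pi>U \<pi>\<rho> J\<pi> U\<pi> \<rho>\<pi> Jb Ub \<rho>b J\<sigma> U\<sigma> \<rho>\<sigma> \<tau>J \<tau>U \<tau>\<rho>
  have \<theta>: "endo \<theta>" "\<And>x. \<theta> (\<kappa> x) = \<theta> x" "\<And>x. \<kappa> (\<theta> x) = \<theta> x"
    by (rule endoI; simp add: \<theta>_def endo_simps lin algebra_simps)
      (simp_all add: \<theta>_def endo_simps lin words)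
  note v = shear_blocks[OF \<theta> v_def]
  have F: "endo F" and G: "endo G"
    by (rule endoI; simp add: F_def G_def endo_simps lin algebra_simps)+
  have GF: "G (F x) = scale c (\<kappa> x)" for x
    by (simp add: F_def G_def endo_simps lin words)
  have F\<kappa>: "F (\<kappa> x) = F x" for x
    by (simp add: F_def endo_simps lin words)
  have r: "idempotent_endomorphism scale r"
  proof (intro idempotent_endomorphismI endoI)
    show "r (x + y) = r x + r y" "r (scale k x) = scale k (r x)" for x y k
      by (simp_all add: r_def endo_simps lin F G algebra_simps)
    have "G (\<sigma> (\<rho> x)) = 0" "\<tau> (F x) = J x" for x
      by (simp_all add: F_def G_def endo_simps lin words)
    then show "r (r x) = r x" for x
      using nz by (simp add: r_def endo_simps lin F G GF F\<kappa> words)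
  qed
  define w where "w x = v x - scale c (r x)" for x
  have cr: "scale c (r x) = F (G x) + scale c (\<sigma> (\<rho> (\<tau> x)))" for x
    using nz by (simp add: r_def scale_right_distrib)
  have "three_idempotents a (- a) c v"
  proof (rule three_idempotents_if_block_form[OF lin_\<pi> _ \<pi>\<pi> r])
    show "endo w"
      by (rule endoI) (simp_all add: w_def cr endo_simps lin v(1) F G algebra_simps)
    show "\<pi> (w (\<pi> x)) = scale (a + - a) (\<pi> x)" for x
      by (simp add: w_def cr endo_simps lin v(2) block \<theta>_def F_def G_def words)
    have "G (x - \<pi> x) = U (\<tau> x)" "\<tau> (x - \<pi> x) = \<tau> x" for x
      by (simp_all add: G_def endo_simps lin words)
    then have "w (x - \<pi> x) - \<pi> (w (x - \<pi> x)) = 0" for x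
      using v(3)[of x]
      by (simp add: w_def cr \<theta>_def F_def endo_add[OF lin_\<pi>] endo_diff[OF lin_\<pi>] endo_scale[OF lin_\<pi>]
          endo_add[OF lin_\<sigma>] endo_scale[OF lin_\<sigma>] words algebra_simps)
    then show "w (x - \<pi> x) = \<pi> (w (x - \<pi> x))" for x
      by simp
    show "v x = w x + scale c (r x)" for x
      by (simp add: w_def)
  qed (use nz in auto)
  then show ?thesis by (rule v(4))
qed

text \<open>
  If the block of \<open>u\<close> on \<open>K\<close> is a mere commutator \<open>J U - U J\<close>, no nonzero scalar is available on \<open>K\<close>.
  It is created artificially: the odd block is written as \<open>a + a'\<close> on the whole odd part plus
  \<open>c = - (a + a')\<close>, and the idempotent with factor \<open>c\<close> now has to act on the whole odd part as
  well. Then \<open>b\<close> cannot be put into \<open>F\<close>, because this would destroy \<open>G F = c \<pi>\<close>. Instead \<open>J\<close> is replaced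
  by \<open>W = \<kappa> + J\<close>, which has the same commutator with \<open>U\<close>, and \<open>U\<close> by \<open>H = U + h\<close>, where \<open>h W = - b\<close>.
\<close>

lemma three_idempotents_if_commutator:
  assumes lin: "endo J" "endo U" "endo h"
    and J: "\<And>x. \<kappa> (J x) = J x" "\<And>x. J (\<kappa> x) = J x"
    and U: "\<And>x. \<kappa> (U x) = U x" "\<And>x. U (\<kappa> x) = U x"
    and h: "\<And>x. \<kappa> (h x) = 0" "\<And>x. h (\<kappa> x) = h x" "\<And>x. \<pi> (h x) = h x"
    and hJ: "\<And>x. h x + h (J x) = - b x"
    and block: "\<And>x. \<kappa> (u (\<kappa> x)) = J (U x) - U (J x)"
    and nz: "a \<noteq> 0" "a' \<noteq> 0" "a + a' \<noteq> 0"
  shows "three_idempotents a a' (- (a + a')) u"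
proof -
  define c where "c = - (a + a')"
  define W where "W x = \<kappa> x + J x" for x
  define H where "H x = U x + h x" for x
  define \<theta> where "\<theta> x = W (U x)" for x
  define v where "v x = u (x - \<sigma> (\<theta> x)) + \<sigma> (\<theta> (u (x - \<sigma> (\<theta> x))))" for x
  define F where "F x = scale c (\<pi> x) - H (W x) + \<sigma> (W x)" for x
  define G where "G x = \<pi> x + H (\<tau> x)" for x
  define r where "r x = scale (1 / c) (F (G x))" for x
  have c: "c \<noteq> 0" using nz by (simp add: c_def add_eq_0_iff)
  note lin = lin lin_u lin_\<pi> lin_\<sigma> lin_\<kappa> lin_\<tau> lin_b
  have \<pi>J: "\<pi> (J x) = J x" and \<pi>U: "\<pi> (U x) = U x" for x
    by (metis J(1) \<pi>\<kappa>, metis U(1) \<pi>\<kappa>)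
  have J\<pi>: "J (\<pi> x) = J x" and U\<pi>: "U (\<pi> x) = U x" and h\<pi>: "h (\<pi> x) = h x" for x
    by (metis J(2) \<kappa>\<pi>, metis U(2) \<kappa>\<pi>, metis h(2) \<kappa>\<pi>)
  have Jh: "J (h x) = 0" and Uh: "U (h x) = 0" and hh: "h (h x) = 0" for x
    by (metis J(2) h(1) endo_zero lin(1), metis U(2) h(1) endo_zero lin(2), metis h(1,2) endo_zero lin(3))
  have J\<sigma>: "J (\<sigma> x) = 0" and U\<sigma>: "U (\<sigma> x) = 0" and h\<sigma>: "h (\<sigma> x) = 0" for x
    by (metis J(2) \<kappa>\<sigma> endo_zero lin(1), metis U(2) \<kappa>\<sigma> endo_zero lin(2), metis h(2) \<kappa>\<sigma> endo_zero lin(3))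
  have \<tau>J: "\<tau> (J x) = 0" and \<tau>U: "\<tau> (U x) = 0" and \<tau>h: "\<tau> (h x) = 0" for x
    by (metis \<tau>\<pi> \<pi>J, metis \<tau>\<pi> \<pi>U, metis \<tau>\<pi> h(3))
  note words = words J U h \<pi>J \<pi>U J\<pi> U\<pi> h\<pi> Jh Uh hh J\<sigma> U\<sigma> h\<sigma> \<tau>J \<tau>U \<tau>h
  have \<theta>: "endo \<theta>" "\<And>x. \<theta> (\<kappa> x) = \<theta> x" "\<And>x. \<kappa> (\<theta> x) = \<theta> x"
    by (rule endoI; simp add: \<theta>_def W_def endo_simps lin algebra_simps)
      (simp_all add: \<theta>_def W_def endo_simps lin words)
  note v = shear_blocks[OF \<theta> v_def]
  have F: "endo F" and G: "endo G"
    by (rule endoI; simp add: F_def G_def H_def W_def endo_simps lin algebra_simps)+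
  have GF: "G (F x) = scale c (\<pi> x)" for x
    by (simp add: F_def G_def H_def W_def endo_simps lin words)
  have F\<pi>: "F (\<pi> x) = F x" for x
    by (simp add: F_def H_def W_def endo_simps lin words)
  have r: "idempotent_endomorphism scale r"
  proof (intro idempotent_endomorphismI endoI)
    show "r (x + y) = r x + r y" "r (scale k x) = scale k (r x)" for x y k
      by (simp_all add: r_def endo_simps lin F G algebra_simps)
    show "r (r x) = r x" for x
      using c by (simp add: r_def endo_simps lin F G GF F\<pi>)
  qed
  define w where "w x = v x - scale c (r x)" for x
  have cr: "scale c (r x) = F (G x)" for x
    using c by (simp add: r_def)
  have "three_idempotents a a' c v"
  proof (rule three_idempotents_if_block_form[OF lin_\<pi> _ \<pi>\<pi> r])
    show "endo w"
      by (rule endoI) (simp_all add: w_def cr endo_simps lin v(1) F G algebra_simps)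
    have "\<pi> (w (\<pi> x)) = J (U x) - U (J x) + b x - \<theta> x - (scale c (\<pi> x) - H (W x))" for x
      by (simp add: w_def cr endo_simps lin v(2) block F_def G_def H_def W_def words)
    also have "\<dots> x = b x - (scale c (\<pi> x) - (h x + h (J x)))" for x
      by (simp add: \<theta>_def H_def W_def endo_simps lin words)
    also have "\<dots> x = scale (a + a') (\<pi> x)" for x
      by (simp add: hJ c_def scale_minus_left[symmetric] del: scale_minus_left)
    finally show "\<pi> (w (\<pi> x)) = scale (a + a') (\<pi> x)" for x .
    have "\<sigma> (h x) = 0" for x
      by (metis \<sigma>\<kappa> h(1) endo_zero lin_\<sigma>)
    moreover have "G (x - \<pi> x) = H (\<tau> x)" "W (h x) = 0" for x
      by (simp_all add: G_def W_def H_def endo_simps lin words)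
    ultimately have "w (x - \<pi> x) - \<pi> (w (x - \<pi> x)) = 0" for x
      using v(3)[of x]
      by (simp add: w_def cr \<theta>_def F_def H_def W_def endo_add[OF lin_\<pi>] endo_diff[OF lin_\<pi>] endo_scale[OF lin_\<pi>]
          endo_add[OF lin_\<sigma>] endo_add[OF lin(1)] endo_scale[OF lin_\<sigma>] words algebra_simps)
    then show "w (x - \<pi> x) = \<pi> (w (x - \<pi> x))" for x
      by simp
    show "v x = w x + scale c (r x)" for x
      by (simp add: w_def)
  qed (use nz in auto)
  then show ?thesis unfolding c_def by (rule v(4))
qed

end

section \<open>Triangular matrices of trace zero are commutators\<close>

context endomorphism_space begin

lemma endo_eq_on_basis:
  assumes "endo f" "endo g" "span B = UNIV" "\<And>x. x \<in> B \<Longrightarrow> f x = g x"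
  shows "f x = g x"
proof -
  have "x \<in> span B" using assms(3) by simp
  then show ?thesis
    by (induction rule: span_induct_alt) (use assms in \<open>simp_all add: endo_simps\<close>)
qed

lemma endo_maps_span:
  assumes "endo f" "subspace S" "\<And>x. x \<in> B \<Longrightarrow> f x \<in> S" "v \<in> span B"
  shows "f v \<in> S"
  using assms(4) by (induction rule: span_induct_alt)
    (use assms in \<open>simp_all add: endo_simps subspace_0 subspace_add subspace_scale\<close>)

lemma endo_span_image:
  assumes "endo f"
  shows "span (f ` S) = f ` span S"
proof -
  interpret pair: vector_space_pair scale scale ..
  show ?thesis
    using assms pair.linear_span_image by (simp add: endomorphism_def)
qed

lemma endo_extend:
  assumes "independent B"
  obtains g where "endo g" "\<And>x. x \<in> B \<Longrightarrow> g x = f x"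
proof -
  interpret pair: vector_space_pair scale scale ..
  show thesis
    using pair.linear_independent_extend[OF assms, of f] that by (auto simp: endomorphism_def)
qed

lemma endo_on_family:
  fixes e f :: "nat \<Rightarrow> 'b"
  assumes B: "independent B" and e: "inj_on e {..<l}" "e ` {..<l} \<subseteq> B"
  obtains g where "endo g" "\<And>i. i < l \<Longrightarrow> g (e i) = f i"
    "\<And>x. x \<in> B \<Longrightarrow> x \<notin> e ` {..<l} \<Longrightarrow> g x = 0"
proof -
  define g0 where "g0 x = (if x \<in> e ` {..<l} then f (the_inv_into {..<l} e x) else 0)" for x
  obtain g where "endo g" "\<And>x. x \<in> B \<Longrightarrow> g x = g0 x"
    using endo_extend[OF B] by blast
  moreover have "g0 (e i) = f i" if "i < l" for i
    using that e(1) by (auto simp: g0_def the_inv_into_f_f)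
  ultimately show thesis
    using e(2) by (intro that[of g]) (auto simp: g0_def)
qed

text \<open>
  With \<open>J\<close> the shift of the family \<open>e\<close>, the equations \<open>J U - U J = R\<close> determine \<open>U (e (j - 1))\<close> from \<open>U (e j)\<close>,
  so they can be solved downwards from \<open>U (e (l - 1)) = 0\<close>; the values are \<open>z 0, z 1, \<dots>\<close>. The
  equation for \<open>e 0\<close> is left over, and it says that the recursion returns to zero after \<open>l\<close> steps.
  It does: by triangularity, the top coefficient of the values is minus a partial sum of the diagonal.
\<close>

lemma commutator_upper_triangular:
  fixes e :: "nat \<Rightarrow> 'b"
  assumes B: "independent B" "span B = UNIV" and e: "inj_on e {..<l}" "e ` {..<l} \<subseteq> B"
    and J: "endo J" "\<And>i. Suc i < l \<Longrightarrow> J (e (Suc i)) = e i" "J (e 0) = 0"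
    and upper: "\<And>j. j < l \<Longrightarrow> R j - scale (d j) (e j) \<in> span (e ` {..<j})"
    and trace: "(\<Sum>j<l. d j) = 0"
  obtains U where "endo U" "\<And>i. i < l \<Longrightarrow> J (U (e i)) - U (J (e i)) = R i"
    "\<And>i. i < l \<Longrightarrow> U (e i) \<in> span (e ` {..<l})" "0 < l \<Longrightarrow> U (e (l - 1)) = 0"
    "\<And>x. x \<in> B \<Longrightarrow> x \<notin> e ` {..<l} \<Longrightarrow> U x = 0"
proof -
  define z where "z = rec_nat 0 (\<lambda>k y. J y - R (l - 1 - k))"
  have z0: "z 0 = 0" and zSuc: "z (Suc k) = J (z k) - R (l - 1 - k)" for k
    by (simp_all add: z_def)
  have z_span: "z k + scale (\<Sum>i=l-k..<l. d i) (e (l - k)) \<in> span (e ` {..<l - k})" if "k \<le> l" for k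
    using that
  proof (induction k)
    case 0
    then show ?case by (simp add: z0 span_zero)
  next
    case (Suc k)
    define T where "T = (\<Sum>i=l-k..<l. d i)"
    define j where "j = l - Suc k"
    have j: "l - k = Suc j" "l - 1 - k = j" "j < l"
      using Suc.prems by (auto simp: j_def)
    have T: "(\<Sum>i=j..<l. d i) = d j + T"
      using j by (simp add: T_def sum.atLeast_Suc_lessThan)
    have shift: "J (scale T (e (Suc j))) = scale T (e j)"
    proof (cases "Suc j < l")
      case True
      then show ?thesis using J by (simp add: endo_scale)
    next
      case False
      \<comment> \<open>Here \<open>e (Suc j)\<close> lies beyond the end of the family, but its coefficient is an empty sum.\<close>
      then have "T = 0" using j by (simp add: T_def)
      then show ?thesis using J(1) by (simp add: endo_zero)
    qed
    have "J (z k + scale T (e (Suc j))) \<in> span (e ` {..<j})"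
    proof (rule endo_maps_span[OF J(1) subspace_span])
      show "z k + scale T (e (Suc j)) \<in> span (e ` {..<Suc j})"
        using Suc j by (simp add: T_def)
      show "J x \<in> span (e ` {..<j})" if "x \<in> e ` {..<Suc j}" for x
      proof -
        obtain i where i: "i < Suc j" "x = e i" using \<open>x \<in> e ` {..<Suc j}\<close> by auto
        show ?thesis
        proof (cases i)
          case 0
          then show ?thesis using i J by (simp add: span_zero)
        next
          case (Suc i')
          then show ?thesis using i j J(2)[of i'] by (auto intro: span_base)
        qed
      qed
    qed
    then have "J (z k) + scale T (e j) \<in> span (e ` {..<j})"
      using shift J(1) by (simp add: endo_add)
    then have "(J (z k) + scale T (e j)) - (R j - scale (d j) (e j)) \<in> span (e ` {..<j})"
      by (rule span_diff) (rule upper[OF j(3)])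
    moreover have "(J (z k) + scale T (e j)) - (R j - scale (d j) (e j))
        = z (Suc k) + scale (d j + T) (e j)"
      by (simp only: zSuc j(2) scale_left_distrib) simp
    ultimately show ?case
      using T j by (simp add: j_def)
  qed
  have zl: "z l = 0"
  proof -
    have "(\<Sum>i=l-l..<l. d i) = 0"
      using trace by (simp add: atLeast0LessThan)
    then show ?thesis
      using z_span[of l] by simp
  qed
  obtain U where U: "endo U" "\<And>i. i < l \<Longrightarrow> U (e i) = z (l - 1 - i)"
      "\<And>x. x \<in> B \<Longrightarrow> x \<notin> e ` {..<l} \<Longrightarrow> U x = 0"
    by (rule endo_on_family[OF B(1) e, of "\<lambda>i. z (l - 1 - i)"]) blast
  show thesis
  proof
    show "J (U (e i)) - U (J (e i)) = R i" if i: "i < l" for i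
    proof (cases i)
      case 0
      have "z l = J (z (l - 1)) - R 0"
        using zSuc[of "l - 1"] i by simp
      then show ?thesis using 0 i zl U J by (simp add: endo_zero)
    next
      case (Suc i')
      have "z (l - i) = J (z (l - 1 - i)) - R i"
        using zSuc[of "l - 1 - i"] i Suc by (simp add: Suc_diff_Suc)
      then show ?thesis using Suc i U J by (simp add: Suc_diff_Suc)
    qed
    show "U (e i) \<in> span (e ` {..<l})" if i: "i < l" for i
    proof (cases "i = l - 1")
      case True
      then show ?thesis using i U(2) by (simp add: z0 span_zero)
    next
      case False
      define k where "k = l - 1 - i"
      define t where "t = (\<Sum>i=l-k..<l. d i)"
      have k: "0 < k" "k \<le> l" using i False by (auto simp: k_def)
      have "z k + scale t (e (l - k)) \<in> span (e ` {..<l})"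
        unfolding t_def by (rule subsetD[OF span_mono z_span[OF k(2)]]) auto
      moreover have "scale t (e (l - k)) \<in> span (e ` {..<l})"
        using k i by (intro span_scale span_base) auto
      ultimately have "z k \<in> span (e ` {..<l})"
        by (metis add_diff_cancel_right' span_diff)
      then show ?thesis using U(2) i by (simp add: k_def)
    qed
    show "U (e (l - 1)) = 0" if "0 < l"
      using U(2)[of "l - 1"] that by (simp add: z0)
  qed (use U in auto)
qed

end

section \<open>Choosing the coefficients\<close>

text \<open>
  A version of the splitting above in terms of an independent set: \<open>P\<close> consists of odd and \<open>Q\<close> of even
  vectors, and \<open>e 0, \<dots>, e (l - 1)\<close> is a basis of \<open>K\<close> with the partners \<open>y i\<close>. Beyond the splitting, the
  block of \<open>u\<close> on \<open>K\<close> is upper triangular. The set need not span the space, so that such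
  data can be enlarged step by step.
\<close>

locale parity_basis = endomorphism_space scale
  for scale :: "'a::field \<Rightarrow> 'b::ab_group_add \<Rightarrow> 'b" +
  fixes u :: "'b \<Rightarrow> 'b" and P Q :: "'b set" and l :: nat and e y :: "nat \<Rightarrow> 'b"
  assumes lin_u: "endomorphism scale u"
    and indep: "independent (P \<union> Q)" and disjoint: "P \<inter> Q = {}"
    and inj_e: "inj_on e {..<l}"
    and e_in: "i < l \<Longrightarrow> e i \<in> P" and y_in: "i < l \<Longrightarrow> y i \<in> Q"
    and u_y: "i < l \<Longrightarrow> u (y i) = e i"
    and u_Q: "x \<in> Q \<Longrightarrow> u x \<in> span P"
    and u_P: "x \<in> P \<Longrightarrow> x \<notin> e ` {..<l} \<Longrightarrow> u x \<in> span Q"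
    and u_e: "i < l \<Longrightarrow> u (e i) \<in> span (e ` {..i} \<union> (P - e ` {..<l}) \<union> Q)"
begin

lemma e_sub: "e ` {..<l} \<subseteq> P \<union> Q"
  using e_in by auto

text \<open>
  The conclusion is quantified because \<open>f\<close> and \<open>g\<close> are then found by pattern unification.
\<close>

lemma endo_eqI:
  assumes span: "span (P \<union> Q) = UNIV" and "endo f" "endo g" "\<And>i. i < l \<Longrightarrow> f (e i) = g (e i)"
    "\<And>x. x \<in> P \<union> Q \<Longrightarrow> x \<notin> e ` {..<l} \<Longrightarrow> f x = g x"
  shows "\<forall>x. f x = g x"
  using endo_eq_on_basis[OF assms(2,3) span] assms(4,5) by blast

text \<open>
  Let \<open>t j\<close> be the diagonal entries of the block of \<open>u\<close> on \<open>K\<close>. This block minus \<open>c\<close> is a commutator once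
  the entries add up to \<open>l c\<close>, and the projection \<open>\<rho>\<close> onto the last basis vector allows \<open>(l + 1) c\<close>
  as well. One of \<open>l\<close> and \<open>l + 1\<close> is nonzero in the field, so a nonzero sum has one of these forms with
  \<open>c \<noteq> 0\<close>. A zero sum has it in characteristic two, since one of \<open>l\<close> and \<open>l + 1\<close> is even; in any other
  characteristic \<open>a + a\<close> is nonzero, and the block itself is a commutator.
\<close>

lemma some_coefficients:
  assumes span: "span (P \<union> Q) = UNIV" and a: "a \<noteq> 0"
  shows "\<exists>b c. three_idempotents a b c u"
proof -
  note family = endo_on_family[OF indep inj_e e_sub]
  note ext = endo_eqI[OF span]
  obtain \<pi> where lin_\<pi>: "endo \<pi>" and \<pi>: "\<And>x. x \<in> P \<union> Q \<Longrightarrow> \<pi> x = (if x \<in> P then x else 0)"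
    by (rule endo_extend[OF indep, of "\<lambda>x. if x \<in> P then x else 0"]) blast
  have \<pi>P: "\<pi> x = x" if "x \<in> P" for x using \<pi> that by simp
  have \<pi>Q: "\<pi> x = 0" if "x \<in> Q" for x using \<pi> that disjoint by auto
  obtain \<kappa> where lin_\<kappa>: "endo \<kappa>" and \<kappa>e: "\<And>i. i < l \<Longrightarrow> \<kappa> (e i) = e i"
      and \<kappa>0: "\<And>x. x \<in> P \<union> Q \<Longrightarrow> x \<notin> e ` {..<l} \<Longrightarrow> \<kappa> x = 0"
    by (rule family[of e]) blast
  obtain \<sigma> where lin_\<sigma>: "endo \<sigma>" and \<sigma>e: "\<And>i. i < l \<Longrightarrow> \<sigma> (e i) = y i"
      and \<sigma>0: "\<And>x. x \<in> P \<union> Q \<Longrightarrow> x \<notin> e ` {..<l} \<Longrightarrow> \<sigma> x = 0"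
    by (rule family[of y]) blast
  obtain J where lin_J: "endo J" and Je: "\<And>i. i < l \<Longrightarrow> J (e i) = (if i = 0 then 0 else e (i - 1))"
      and J0: "\<And>x. x \<in> P \<union> Q \<Longrightarrow> x \<notin> e ` {..<l} \<Longrightarrow> J x = 0"
    by (rule family[of "\<lambda>i. if i = 0 then 0 else e (i - 1)"]) blast
  note lin = lin_u lin_\<pi> lin_\<kappa> lin_\<sigma> lin_J
  have \<pi>_span: "\<pi> x = x" if "x \<in> span P" for x
    using that by (induction rule: span_induct_alt) (auto simp: endo_simps lin \<pi>P)
  have \<pi>_span0: "\<pi> x = 0" if "x \<in> span Q" for x
    using that by (induction rule: span_induct_alt) (auto simp: endo_simps lin \<pi>Q)
  have \<kappa>_span: "\<kappa> x = x" if "x \<in> span (e ` {..<l})" for x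
    using that by (induction rule: span_induct_alt) (auto simp: endo_simps lin \<kappa>e)
  have Q_notin: "x \<notin> e ` {..<l}" if "x \<in> Q" for x
    using that disjoint e_in by auto
  have \<pi>e: "\<pi> (e i) = e i" and \<pi>y: "\<pi> (y i) = 0" if "i < l" for i
    using that e_in y_in \<pi>P \<pi>Q by simp_all
  have \<kappa>\<pi>0: "\<kappa> (\<pi> x) = 0" if "x \<in> P \<union> Q" "x \<notin> e ` {..<l}" for x
    using \<kappa>0[OF that] that(1) by (cases "x \<in> P") (simp_all add: \<pi>P \<pi>Q endo_zero lin)
  have \<pi>0: "\<pi> (\<pi> x) = \<pi> x" "\<pi> (u (x - \<pi> x)) = u (x - \<pi> x)" if "x \<in> P \<union> Q" for x
    using that u_Q by (cases "x \<in> P"; simp add: \<pi>P \<pi>Q \<pi>_span endo_zero lin)+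
  have \<pi>\<kappa>0: "\<pi> (u (\<pi> x - \<kappa> x)) = 0" if "x \<in> P \<union> Q" "x \<notin> e ` {..<l}" for x
    using that u_P by (cases "x \<in> P") (simp_all add: \<pi>P \<pi>Q \<kappa>0 \<pi>_span0 endo_zero lin)
  have relations:
    "\<forall>x. \<pi> (\<pi> x) = \<pi> x" "\<forall>x. \<pi> (u (x - \<pi> x)) = u (x - \<pi> x)" "\<forall>x. \<pi> (u (\<pi> x - \<kappa> x)) = 0"
    "\<forall>x. \<kappa> (\<kappa> x) = \<kappa> x" "\<forall>x. \<pi> (\<kappa> x) = \<kappa> x" "\<forall>x. \<kappa> (\<pi> x) = \<kappa> x"
    "\<forall>x. \<pi> (\<sigma> x) = 0" "\<forall>x. \<sigma> (\<kappa> x) = \<sigma> x" "\<forall>x. u (\<sigma> x) = \<kappa> x"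
    subgoal by (rule ext; (rule endoI)?; use \<pi>0 e_sub in \<open>simp add: endo_add endo_scale lin \<pi>e\<close>)
    subgoal by (rule ext; (rule endoI)?; use \<pi>0 in \<open>simp add: endo_simps lin \<pi>e algebra_simps\<close>)
    subgoal by (rule ext; (rule endoI)?; use \<pi>\<kappa>0 in \<open>simp add: endo_simps lin \<pi>e \<kappa>e algebra_simps\<close>)
    by (rule ext; (rule endoI)?; simp add: endo_simps lin \<kappa>e \<kappa>0 \<sigma>e \<sigma>0 u_y \<pi>e \<pi>y \<kappa>\<pi>0)+
  interpret parity_splitting scale u \<pi> \<kappa> \<sigma>
    by unfold_locales (use relations lin in blast)+
  have "\<exists>k. \<kappa> (u (e j)) - scale k (e j) \<in> span (e ` {..<j})" if j: "j < l" for j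
  proof -
    have "\<kappa> x \<in> span (e ` {..j})" if "x \<in> e ` {..j} \<union> (P - e ` {..<l}) \<union> Q" for x
      using that j \<kappa>0 \<kappa>e Q_notin by (auto simp: span_zero intro: span_base)
    then have "\<kappa> (u (e j)) \<in> span (e ` {..j})"
      using endo_maps_span[OF lin_\<kappa> subspace_span] u_e[OF j] by blast
    moreover have "e ` {..j} = insert (e j) (e ` {..<j})"
      by (auto simp: le_less)
    ultimately show ?thesis by (simp add: span_breakdown_eq)
  qed
  then obtain t where t: "\<And>j. j < l \<Longrightarrow> \<kappa> (u (e j)) - scale (t j) (e j) \<in> span (e ` {..<j})"
    by metis
  have J_in: "J (e i) \<in> span (e ` {..<l})" if "i < l" for i
    using Je that by (auto intro: span_base simp: span_zero)
  have J: "\<forall>x. \<kappa> (J x) = J x" "\<forall>x. J (\<kappa> x) = J x"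
    by (rule ext; (rule endoI)?; use \<kappa>_span J_in in \<open>simp add: endo_simps lin \<kappa>e \<kappa>0 J0\<close>)+
  have commutator: "\<exists>U. endo U \<and> (\<forall>x. \<kappa> (U x) = U x) \<and> (\<forall>x. U (\<kappa> x) = U x) \<and>
      (0 < l \<longrightarrow> U (e (l - 1)) = 0) \<and> (\<forall>x. J (U x) - U (J x) = R (\<kappa> x))"
    if R: "endo R" and upper: "\<And>j. j < l \<Longrightarrow> R (e j) - scale (d j) (e j) \<in> span (e ` {..<j})"
      and trace: "(\<Sum>j<l. d j) = 0" for R d
  proof (cases "l = 0")
    case True
    have "\<forall>x. \<kappa> x = 0" "\<forall>x. J x = 0"
      by (rule ext; (rule endoI)?; use True in \<open>simp add: endo_simps lin \<kappa>0 J0\<close>)+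
    then have [simp]: "\<kappa> x = 0" "J x = 0" for x by simp_all
    show ?thesis
      by (rule exI[of _ "\<lambda>x. 0"]) (use True R in \<open>auto intro: endoI simp: endo_zero\<close>)
  next
    case False
    have "J (e 0) = 0" "\<And>i. Suc i < l \<Longrightarrow> J (e (Suc i)) = e i"
      using False Je by auto
    then obtain U where U: "endo U" "\<And>i. i < l \<Longrightarrow> J (U (e i)) - U (J (e i)) = R (e i)"
      "\<And>i. i < l \<Longrightarrow> U (e i) \<in> span (e ` {..<l})" "0 < l \<Longrightarrow> U (e (l - 1)) = 0"
      "\<And>x. x \<in> P \<union> Q \<Longrightarrow> x \<notin> e ` {..<l} \<Longrightarrow> U x = 0"
      using commutator_upper_triangular[OF indep span inj_e e_sub lin_J _ _ upper trace] by blast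
    have "\<forall>x. \<kappa> (U x) = U x" "\<forall>x. U (\<kappa> x) = U x"
      by (rule ext; (rule endoI)?; use \<kappa>_span U in \<open>simp add: endo_simps lin \<kappa>e \<kappa>0\<close>)+
    moreover have "\<forall>x. J (U x) - U (J x) = R (\<kappa> x)"
      by (rule ext; (rule endoI)?; use U R in \<open>simp add: endo_simps lin \<kappa>e \<kappa>0 J0 algebra_simps\<close>)
    ultimately show ?thesis using U by blast
  qed
  have nonzero: ?thesis if c: "c \<noteq> 0" "(of_nat l + \<epsilon>) * c = (\<Sum>j<l. t j)" and \<epsilon>: "\<epsilon> = 0 \<or> (\<epsilon> = 1 \<and> 0 < l)" for c \<epsilon>
  proof -
    \<comment> \<open>The projection \<open>\<rho>\<close> is onto the last vector because the shift \<open>J\<close> never reaches it and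
      \<open>U\<close> annihilates it.\<close>
    define f where "f i = (if i = l - 1 then scale \<epsilon> (e i) else 0)" for i
    obtain \<rho> where lin_\<rho>: "endo \<rho>" and \<rho>e: "\<And>i. i < l \<Longrightarrow> \<rho> (e i) = f i"
      and \<rho>0: "\<And>x. x \<in> P \<union> Q \<Longrightarrow> x \<notin> e ` {..<l} \<Longrightarrow> \<rho> x = 0"
      by (rule family[of f]) blast
    note lin = lin lin_\<rho>
    define R where "R x = \<kappa> (u x) - scale c x - scale c (\<rho> x)" for x
    define d where "d j = t j - c - (if j = l - 1 then c * \<epsilon> else 0)" for j
    have "endo R"
      by (rule endoI) (simp_all add: R_def endo_simps lin algebra_simps)
    moreover have "R (e j) - scale (d j) (e j) \<in> span (e ` {..<j})" if "j < l" for j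
    proof -
      have "R (e j) - scale (d j) (e j) = \<kappa> (u (e j)) - scale (t j) (e j)"
        using that by (simp add: R_def d_def \<rho>e f_def algebra_simps)
      then show ?thesis using t that by simp
    qed
    moreover have "(\<Sum>j<l. d j) = 0"
    proof -
      have "(\<Sum>j<l. if j = l - 1 then c * \<epsilon> else 0) = c * \<epsilon>"
        using \<epsilon> by (auto simp: sum.delta)
      then have "(\<Sum>j<l. d j) = (\<Sum>j<l. t j) - of_nat l * c - c * \<epsilon>"
        unfolding d_def sum_subtractf by simp
      also have "\<dots> = 0" unfolding c(2)[symmetric] by (simp add: algebra_simps)
      finally show ?thesis .
    qed
    ultimately obtain U where U: "endo U" "\<And>x. \<kappa> (U x) = U x" "\<And>x. U (\<kappa> x) = U x"
        "0 < l \<Longrightarrow> U (e (l - 1)) = 0" "\<And>x. J (U x) - U (J x) = R (\<kappa> x)"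
      using commutator[of R d] by blast
    have \<rho>: "\<forall>x. \<kappa> (\<rho> x) = \<rho> x" "\<forall>x. \<rho> (\<kappa> x) = \<rho> x" "\<forall>x. \<rho> (\<rho> x) = \<rho> x"
      "\<forall>x. \<rho> (J x) = 0" "\<forall>x. U (\<rho> x) = 0"
      by (rule ext; (rule endoI)?; use \<epsilon> U in \<open>auto simp: endo_simps lin \<kappa>e \<kappa>0 \<rho>e \<rho>0 Je J0 f_def\<close>)+
    have "three_idempotents a (- a) c u"
      by (rule three_idempotents_if_scalar_plus_commutator[OF lin_J U(1) lin_\<rho> J[rule_format] U(2,3) \<rho>[rule_format]])
        (use c a U(5) \<rho>(2) in \<open>simp_all add: R_def algebra_simps\<close>)
    then show ?thesis by blast
  qed
  have zero: ?thesis if t0: "(\<Sum>j<l. t j) = 0" and char: "(2::'a) \<noteq> 0"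
  proof -
    have "endo (\<lambda>x. \<kappa> (u x))"
      by (rule endoI) (simp_all add: endo_simps lin)
    then obtain U where U: "endo U" "\<And>x. \<kappa> (U x) = U x" "\<And>x. U (\<kappa> x) = U x"
        "\<And>x. J (U x) - U (J x) = \<kappa> (u (\<kappa> x))"
      using commutator[of "\<lambda>x. \<kappa> (u x)" t] t t0 by blast
    \<comment> \<open>The solution of \<open>h (1 + J) = - b\<close>, from the first basis vector upwards.\<close>
    define f where "f = rec_nat (- b (e 0)) (\<lambda>i z. - b (e (Suc i)) - z)"
    obtain h where lin_h: "endo h" and he: "\<And>i. i < l \<Longrightarrow> h (e i) = f i"
      and h0: "\<And>x. x \<in> P \<union> Q \<Longrightarrow> x \<notin> e ` {..<l} \<Longrightarrow> h x = 0"
      by (rule family[of f]) blast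
    note lin = lin lin_h lin_b
    have f: "\<kappa> (f i) = 0" "\<pi> (f i) = f i" for i
      by (induction i; simp add: f_def endo_simps lin words)+
    have h: "\<forall>x. \<kappa> (h x) = 0" "\<forall>x. h (\<kappa> x) = h x" "\<forall>x. \<pi> (h x) = h x"
      by (rule ext; (rule endoI)?; use f in \<open>simp add: endo_simps lin \<kappa>e \<kappa>0 he h0\<close>)+
    have recursion: "f i + h (J (e i)) = - b (e i)" if "i < l" for i
      using that by (cases i) (auto simp: Je he f_def endo_simps lin)
    have b0: "b x = 0" if "x \<in> P \<union> Q" "x \<notin> e ` {..<l}" for x
      using b\<kappa>[of x] \<kappa>0[OF that] lin_b by (simp add: endo_zero)
    have hJ: "\<forall>x. h x + h (J x) = - b x"
      by (rule ext; (rule endoI)?; simp add: endo_simps lin he h0 J0 recursion b0 algebra_simps)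
    have "three_idempotents a a (- (a + a)) u"
    proof (rule three_idempotents_if_commutator[OF lin_J U(1) lin_h J[rule_format] U(2,3) h[rule_format] hJ[rule_format]])
      have "a + a = 2 * a" by simp
      then show "a + a \<noteq> 0" using a char by simp
    qed (use a U(4) in simp_all)
    then show ?thesis by blast
  qed
  consider "(\<Sum>j<l. t j) \<noteq> 0" "of_nat l \<noteq> (0::'a)" | "(\<Sum>j<l. t j) \<noteq> 0" "of_nat l = (0::'a)"
    | "(\<Sum>j<l. t j) = 0" "(2::'a) \<noteq> 0" | "(\<Sum>j<l. t j) = 0" "(2::'a) = 0" "even l"
    | "(\<Sum>j<l. t j) = 0" "(2::'a) = 0" "odd l" by blast
  then show ?thesis
  proof cases
    case 1
    then show ?thesis by (intro nonzero[of "(\<Sum>j<l. t j) / of_nat l" 0]) auto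
  next
    case 2
    then have "0 < l" by (intro gr0I) auto
    with 2 show ?thesis by (intro nonzero[of "\<Sum>j<l. t j" 1]) auto
  next
    case 3
    then show ?thesis by (rule zero)
  next
    case 4
    then show ?thesis by (intro nonzero[of 1 0]) (auto elim!: evenE)
  next
    case 5
    then have "of_nat l + 1 = (0::'a)" by (auto elim!: oddE)
    with 5 show ?thesis by (intro nonzero[of 1 1]) (auto intro: odd_pos)
  qed
qed

end

section \<open>A basis of Krylov chains\<close>

context endomorphism_space begin

text \<open>
  The kernel of a finite-rank map has finite codimension.
\<close>

lemma kernel_not_in_finite_span:
  assumes u: "endo u" and R: "finite R" "range u \<subseteq> span R"
    and inf: "infinite_dimensional scale" and T: "finite T"
  obtains z where "u z = 0" "z \<notin> span T"
proof -
  have "\<exists>z. u z = 0 \<and> z \<notin> span T"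
  proof (rule ccontr)
    assume "\<not> ?thesis"
    then have ker: "z \<in> span T" if "u z = 0" for z using that by blast
    obtain D where D: "D \<subseteq> range u" "independent D" "range u \<subseteq> span D"
      using maximal_independent_subset[of "range u"] by blast
    have "finite D"
      using independent_span_bound[OF R(1) D(2)] D(1) R(2) by auto
    define D' where "D' = inv u ` D"
    have uD': "u ` D' = D"
      using D(1) by (force simp: D'_def image_image f_inv_into_f)
    have "v \<in> span (T \<union> D')" for v
    proof -
      have "u v \<in> span (u ` D')" using D(3) uD' by auto
      also have "span (u ` D') = u ` span D'"
        using u by (rule endo_span_image)
      finally obtain v' where v': "v' \<in> span D'" "u v = u v'" by auto
      then have "v - v' \<in> span T"
        using ker[of "v - v'"] u by (simp add: endo_diff)
      then have "(v - v') + v' \<in> span (T \<union> D')"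
        using v' span_mono[of T "T \<union> D'"] span_mono[of D' "T \<union> D'"] by (intro span_add) auto
      then show ?thesis by simp
    qed
    then have UN: "span (T \<union> D') = UNIV" by auto
    obtain E where E: "E \<subseteq> T \<union> D'" "independent E" "T \<union> D' \<subseteq> span E"
      using maximal_independent_subset by blast
    have "span E = UNIV"
      using E(3) UN span_minimal[OF E(3) subspace_span] by auto
    moreover have "finite E"
      using E(1) T \<open>finite D\<close> by (auto simp: D'_def intro: finite_subset)
    ultimately have "finite_dim_subspace scale UNIV"
      unfolding finite_dim_subspace_def using E(2) by blast
    with inf show False by (simp add: infinite_dimensional_def)
  qed
  then show thesis using that by blast
qed

text \<open>
  The last condition says that the span contains no image except those of its own vectors. It is
  maintained by starting every chain outside the range of \<open>u\<close> modulo the earlier chains. Once the span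
  contains the whole range of \<open>u\<close>, the condition implies that the span and the kernel of \<open>u\<close> together
  generate the space.
\<close>

definition chain_system :: "('b \<Rightarrow> 'b) \<Rightarrow> nat \<Rightarrow> 'b set \<Rightarrow> 'b set \<Rightarrow> (nat \<Rightarrow> 'b) \<Rightarrow> (nat \<Rightarrow> 'b) \<Rightarrow> bool" where
  "chain_system u l P Q e y \<longleftrightarrow> parity_basis scale u P Q l e y \<and> finite P \<and> finite Q \<and>
     (\<forall>w. u w \<in> span (P \<union> Q) \<longrightarrow> (\<exists>b \<in> span (P \<union> Q). u w = u b))"

text \<open>
  The iterates of \<open>x\<^sub>0\<close> are independent modulo \<open>B\<close> up to some first dependence, which occurs since all
  iterates but \<open>x\<^sub>0\<close> lie in a space of finite dimension. The conditions on \<open>x\<^sub>0\<close> and \<open>u x\<^sub>0\<close> give the chain at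
  least two vectors, so that its last vector has its predecessor as a partner.
\<close>

lemma krylov_chain:
  assumes u: "endo u" and R: "finite R" "range u \<subseteq> span R"
    and B: "independent B" and x0: "x\<^sub>0 \<notin> span (B \<union> R)" and ux0: "u x\<^sub>0 \<notin> span B"
  obtains m where "2 \<le> m" "inj_on (\<lambda>j. (u ^^ j) x\<^sub>0) {..<m}" "\<And>j. j < m \<Longrightarrow> (u ^^ j) x\<^sub>0 \<notin> B"
    "independent (B \<union> (\<lambda>j. (u ^^ j) x\<^sub>0) ` {..<m})"
    "(u ^^ m) x\<^sub>0 \<in> span (B \<union> (\<lambda>j. (u ^^ j) x\<^sub>0) ` {..<m})"
proof -
  define x where "x j = (u ^^ j) x\<^sub>0" for j
  have xR: "x (Suc j) \<in> span R" for j
    using R(2) by (auto simp: x_def)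
  have free: "inj_on x {..<k} \<and> (\<forall>j<k. x j \<notin> B) \<and> independent (B \<union> x ` {..<k})"
    if "\<And>j. j < k \<Longrightarrow> x j \<notin> span (B \<union> x ` {..<j})" for k
    using that
  proof (induction k)
    case 0
    then show ?case using B by simp
  next
    case (Suc k)
    then have IH: "inj_on x {..<k}" "\<forall>j<k. x j \<notin> B" "independent (B \<union> x ` {..<k})"
      and xk: "x k \<notin> span (B \<union> x ` {..<k})" by simp_all
    have new: "x k \<notin> B" "x k \<notin> x ` {..<k}"
      using xk by (auto intro: span_base)
    have "independent (insert (x k) (B \<union> x ` {..<k}))"
      by (rule independent_insertI[OF xk IH(3)])
    with new IH show ?case
      by (auto simp: lessThan_Suc less_Suc_eq)
  qed
  have "\<exists>k. x k \<in> span (B \<union> x ` {..<k})"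
  proof (rule ccontr)
    assume "\<not> ?thesis"
    then have free: "inj_on x {..<k}" "independent (B \<union> x ` {..<k})" for k
      using free[of k] by auto
    define I where "I = {1..<card R + 2}"
    have "I \<subseteq> {..<card R + 2}" by (auto simp: I_def)
    then have sub: "x ` I \<subseteq> B \<union> x ` {..<card R + 2}" by auto
    have "inj_on x I"
      using free(1) \<open>I \<subseteq> _\<close> by (rule inj_on_subset)
    moreover have "independent (x ` I)"
      using free(2) sub by (rule independent_mono)
    moreover have "x i \<in> span R" if "i \<in> I" for i
      using that xR[of "i - 1"] by (simp add: I_def)
    ultimately have "card I \<le> card R"
      using independent_span_bound[OF R(1), of "x ` I"] by (auto simp: card_image)
    then show False by (simp add: I_def)
  qed
  then obtain m where m: "x m \<in> span (B \<union> x ` {..<m})"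
    and min: "\<And>j. j < m \<Longrightarrow> x j \<notin> span (B \<union> x ` {..<j})"
    using exists_least_iff[of "\<lambda>k. x k \<in> span (B \<union> x ` {..<k})"] by blast
  have "m \<noteq> 0"
  proof
    assume "m = 0"
    then have "x\<^sub>0 \<in> span B" using m by (simp add: x_def)
    then show False using x0 span_mono[of B "B \<union> R"] by auto
  qed
  moreover have "m \<noteq> 1"
  proof
    assume "m = 1"
    then have "u x\<^sub>0 \<in> span (insert x\<^sub>0 B)" using m by (simp add: x_def lessThan_Suc)
    then have "x\<^sub>0 \<in> span (insert (u x\<^sub>0) B)" by (rule in_span_insert[OF _ ux0])
    also have "\<dots> \<subseteq> span (B \<union> R)"
    proof (rule span_minimal[OF _ subspace_span])
      have "u x\<^sub>0 \<in> span R" using R(2) by auto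
      then show "insert (u x\<^sub>0) B \<subseteq> span (B \<union> R)"
        using span_mono[of R "B \<union> R"] by (auto intro: span_base)
    qed
    finally show False using x0 by simp
  qed
  ultimately have "2 \<le> m" by simp
  then show thesis
    using that[of m] free[of m] min m unfolding x_def by blast
qed

text \<open>
  A new chain is added. Its last vector becomes the new basis vector of \<open>K\<close>, and parity alternates along the
  chain, counted from the end. All other vectors of the chain are mapped to the next one,
  which has the opposite parity; the image of the last vector is only known to lie in the new span,
  and this is all that triangularity asks for.
\<close>

lemma chain_system_extend:
  assumes sys: "chain_system u l P Q e y" and R: "finite R" "range u \<subseteq> span R"
    and inf: "infinite_dimensional scale" and w: "u w \<notin> span (P \<union> Q)"
  shows "\<exists>P' Q' e' y'. chain_system u (Suc l) P' Q' e' y'"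
proof -
  interpret parity_basis scale u P Q l e y
    using sys by (simp add: chain_system_def)
  define B where "B = P \<union> Q"
  have fin: "finite P" "finite Q" and depth: "\<And>w. u w \<in> span B \<Longrightarrow> \<exists>b \<in> span B. u w = u b"
    using sys by (auto simp: chain_system_def B_def)
  \<comment> \<open>A generic kernel vector moves \<open>w\<close> away from the range of \<open>u\<close> without changing \<open>u w\<close>.\<close>
  obtain z where z: "u z = 0" "z \<notin> span (insert w (B \<union> R))"
    using kernel_not_in_finite_span[OF lin_u R inf, of "insert w (B \<union> R)"] fin R(1)
    by (auto simp: B_def)
  define x\<^sub>0 where "x\<^sub>0 = w + z"
  have x0: "x\<^sub>0 \<notin> span (B \<union> R)"
  proof
    assume "x\<^sub>0 \<in> span (B \<union> R)"
    then have "x\<^sub>0 - w \<in> span (insert w (B \<union> R))"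
      using span_mono[of "B \<union> R" "insert w (B \<union> R)"] by (intro span_diff) (auto intro: span_base)
    with z show False by (simp add: x\<^sub>0_def)
  qed
  have "u x\<^sub>0 \<notin> span B"
    using w z by (simp add: x\<^sub>0_def endo_add lin_u B_def)
  with x0 indep obtain m where m: "2 \<le> m" "inj_on (\<lambda>j. (u ^^ j) x\<^sub>0) {..<m}"
      "\<And>j. j < m \<Longrightarrow> (u ^^ j) x\<^sub>0 \<notin> B" "independent (B \<union> (\<lambda>j. (u ^^ j) x\<^sub>0) ` {..<m})"
      "(u ^^ m) x\<^sub>0 \<in> span (B \<union> (\<lambda>j. (u ^^ j) x\<^sub>0) ` {..<m})"
    using krylov_chain[OF lin_u R] unfolding B_def by blast
  define x where "x j = (u ^^ j) x\<^sub>0" for j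
  have ux: "u (x j) = x (Suc j)" for j by (simp add: x_def)
  have inj_x: "inj_on x {..<m}" and xB: "\<And>j. j < m \<Longrightarrow> x j \<notin> B"
    and indep_x: "independent (B \<union> x ` {..<m})" and xm: "x m \<in> span (B \<union> x ` {..<m})"
    using m(2-) by (simp_all add: x_def[abs_def])
  define O' where "O' = {j. j < m \<and> even (m - 1 - j)}"
  define E' where "E' = {j. j < m \<and> odd (m - 1 - j)}"
  define P' where "P' = P \<union> x ` O'"
  define Q' where "Q' = Q \<union> x ` E'"
  define e' where "e' = e(l := x (m - 1))"
  define y' where "y' = y(l := x (m - 2))"
  have OE: "O' \<union> E' = {..<m}" "O' \<inter> E' = {}" by (auto simp: O'_def E'_def)
  have PQ': "P' \<union> Q' = B \<union> x ` {..<m}"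
    unfolding P'_def Q'_def B_def OE(1)[symmetric] by blast
  have fin_O': "finite (x ` O')" and fin_E': "finite (x ` E')" by (simp_all add: O'_def E'_def)
  have last: "m - 1 \<in> O'" and prev: "m - 2 \<in> E'"
    using m(1) by (auto simp: O'_def E'_def)
  have e'_old: "e' ` {..<l} = e ` {..<l}" and e'_eq: "e' ` {..<Suc l} = insert (x (m - 1)) (e ` {..<l})"
    by (auto simp: e'_def lessThan_Suc)
  have xl: "x (m - 1) \<notin> P \<union> Q" using xB[of "m - 1"] m(1) by (simp add: B_def)
  have "parity_basis scale u P' Q' (Suc l) e' y'"
  proof unfold_locales
    show "endo u" by (fact lin_u)
    show "independent (P' \<union> Q')" using indep_x by (simp add: PQ')
    show "P' \<inter> Q' = {}"
    proof -
      have "x ` O' \<inter> x ` E' = {}"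
        using inj_on_image_Int[OF inj_x, of O' E'] OE by auto
      moreover have "x ` {..<m} \<inter> B = {}" using xB by auto
      then have "x ` O' \<inter> B = {}" "x ` E' \<inter> B = {}" using OE(1) by auto
      ultimately show ?thesis using disjoint unfolding P'_def Q'_def B_def by blast
    qed
    show "inj_on e' {..<Suc l}"
    proof -
      have "inj_on e' {..<l}"
        using inj_e by (simp add: e'_def inj_on_def)
      moreover have "e' l \<notin> e' ` {..<l}"
        unfolding e'_old using xl e_sub by (auto simp: e'_def)
      ultimately show ?thesis by (auto simp: lessThan_Suc)
    qed
    show "e' i \<in> P'" if "i < Suc l" for i
      using that e_in last by (auto simp: e'_def P'_def)
    show "y' i \<in> Q'" if "i < Suc l" for i
      using that y_in prev by (auto simp: y'_def Q'_def)
    show "u (y' i) = e' i" if "i < Suc l" for i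
      using that u_y ux[of "m - 2"] m(1) by (auto simp: y'_def e'_def Suc_diff_Suc numeral_2_eq_2)
    show "u v \<in> span P'" if v: "v \<in> Q'" for v
    proof (cases "v \<in> Q")
      case True
      then show ?thesis using v u_Q span_mono[of P P'] by (auto simp: P'_def)
    next
      case False
      then obtain j where j: "v = x j" "j < m" "odd (m - 1 - j)" using v by (auto simp: Q'_def E'_def)
      then have "Suc j \<in> O'" by (cases "Suc j = m") (auto simp: O'_def)
      then show ?thesis using j by (auto simp: P'_def ux intro: span_base)
    qed
    show "u v \<in> span Q'" if v: "v \<in> P'" "v \<notin> e' ` {..<Suc l}" for v
    proof (cases "v \<in> P")
      case True
      then show ?thesis using v u_P span_mono[of Q Q'] by (auto simp: Q'_def e'_eq)
    next
      case False
      then obtain j where j: "v = x j" "j < m" "even (m - 1 - j)" using v by (auto simp: P'_def O'_def)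
      moreover have "j \<noteq> m - 1" using v j by (auto simp: e'_eq)
      ultimately have "Suc j \<in> E'" by (auto simp: E'_def)
      then show ?thesis using j by (auto simp: Q'_def ux intro: span_base)
    qed
    show "u (e' i) \<in> span (e' ` {..i} \<union> (P' - e' ` {..<Suc l}) \<union> Q')" if i: "i < Suc l" for i
    proof (cases "i = l")
      case True
      have "P' \<union> Q' \<subseteq> e' ` {..l} \<union> (P' - e' ` {..<Suc l}) \<union> Q'"
        by (auto simp: lessThan_Suc_atMost)
      moreover have "u (e' l) \<in> span (P' \<union> Q')"
        using xm ux[of "m - 1"] m(1) by (simp add: e'_def PQ')
      ultimately show ?thesis using True span_mono by blast
    next
      case False
      then have "i < l" using i by simp
      have e'_i: "e' ` {..i} = e ` {..i}" "e' i = e i"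
        using \<open>i < l\<close> by (auto simp: e'_def)
      have "e ` {..i} \<union> (P - e ` {..<l}) \<union> Q \<subseteq> e ` {..i} \<union> (P' - e' ` {..<Suc l}) \<union> Q'"
        using xl unfolding e'_eq by (auto simp: P'_def Q'_def)
      then show ?thesis
        unfolding e'_i using u_e[OF \<open>i < l\<close>] span_mono by blast
    qed
  qed
  moreover have "\<exists>b \<in> span (P' \<union> Q'). u v = u b" if v: "u v \<in> span (P' \<union> Q')" for v
  proof -
    define S where "S = x ` {..<m - 1}"
    have xS: "x ` {..<m} = insert (x 0) (u ` S)"
    proof -
      have "{..<m} = insert 0 (Suc ` {..<m - 1})"
        using m(1) lessThan_Suc_eq_insert_0[of "m - 1"] by simp
      then show ?thesis by (simp add: S_def image_image ux)
    qed
    have "u v \<in> span (insert (x 0) (B \<union> u ` S))"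
      using v by (simp add: PQ' xS)
    moreover have "x 0 \<notin> span (insert (u v) (B \<union> u ` S))"
    proof
      assume "x 0 \<in> span (insert (u v) (B \<union> u ` S))"
      also have "\<dots> \<subseteq> span (B \<union> R)"
      proof (rule span_minimal[OF _ subspace_span])
        show "insert (u v) (B \<union> u ` S) \<subseteq> span (B \<union> R)"
          using R(2) span_mono[of R "B \<union> R"] by (auto intro: span_base)
      qed
      finally show False using x0 by (simp add: x_def)
    qed
    \<comment> \<open>The first vector of the chain cannot contribute to an image.\<close>
    ultimately have "u v \<in> span (B \<union> u ` S)"
      using in_span_insert[of "u v" "x 0" "B \<union> u ` S"] by blast
    then obtain b s where bs: "u v = b + s" "b \<in> span B" "s \<in> span (u ` S)"
      by (auto simp: span_Un)
    have "span (u ` S) = u ` span S"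
      using lin_u by (rule endo_span_image)
    then obtain s' where s': "s = u s'" "s' \<in> span S" using bs by auto
    then have "u (v - s') \<in> span B" using bs by (simp add: endo_diff lin_u)
    then obtain b' where b': "b' \<in> span B" "u (v - s') = u b'" using depth by blast
    have "S \<subseteq> x ` {..<m}" by (auto simp: S_def)
    then have "b' + s' \<in> span (P' \<union> Q')"
      unfolding PQ' using b' s' span_mono[of B "B \<union> x ` {..<m}"] span_mono[of S "B \<union> x ` {..<m}"]
      by (intro span_add) auto
    moreover have "u v = u (b' + s')"
      using b' by (simp add: endo_simps lin_u algebra_simps)
    ultimately show ?thesis by blast
  qed
  ultimately have "chain_system u (Suc l) P' Q' e' y'"
    using fin_O' fin_E' fin unfolding chain_system_def by (simp add: P'_def Q'_def)
  then show ?thesis by blast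
qed

text \<open>
  The vectors \<open>e i\<close> are independent in the range of \<open>u\<close>, so the number of chains is bounded. For a maximal
  system the span contains the range of \<open>u\<close>, and a basis is completed by kernel vectors, which may
  be declared even.
\<close>

lemma parity_basis_exists:
  assumes u: "endo u" and fr: "finite_rank scale u" and inf: "infinite_dimensional scale"
  obtains l P Q e y where "parity_basis scale u P Q l e y" "span (P \<union> Q) = UNIV"
proof -
  obtain R where R: "finite R" "range u \<subseteq> span R"
    using fr unfolding finite_rank_def finite_dim_subspace_def by blast
  define good where "good l \<longleftrightarrow> (\<exists>P Q e y. chain_system u l P Q e y)" for l
  have "parity_basis scale u {} {} 0 (\<lambda>_. 0) (\<lambda>_. 0)"
    by unfold_locales (auto simp: u independent_empty)
  then have "chain_system u 0 {} {} (\<lambda>_. 0) (\<lambda>_. 0)"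
    by (simp add: chain_system_def endo_zero u)
  then have good0: "good 0" unfolding good_def by blast
  have bound: "l \<le> card R" if l: "good l" for l
  proof -
    obtain P Q e y where "parity_basis scale u P Q l e y"
      using l unfolding good_def chain_system_def by blast
    then interpret parity_basis scale u P Q l e y .
    have "independent (e ` {..<l})" using indep e_sub by (rule independent_mono)
    moreover have "e ` {..<l} \<subseteq> span R" using R(2) u_y by (metis image_subset_iff lessThan_iff range_subsetD)
    ultimately show ?thesis
      using independent_span_bound[OF R(1)] inj_e by (metis card_image card_lessThan)
  qed
  define l where "l = Greatest good"
  have "good l"
    unfolding l_def using good0 bound by (rule GreatestI_nat)
  moreover have "\<not> good (Suc l)"
    using Greatest_le_nat[of good "Suc l"] bound by (auto simp: l_def)
  ultimately have l: "good l" "\<not> good (Suc l)" by simp_all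
  obtain P Q e y where sys: "chain_system u l P Q e y"
    using l(1) by (auto simp: good_def)
  then interpret parity_basis scale u P Q l e y
    by (simp add: chain_system_def)
  have range: "u w \<in> span (P \<union> Q)" for w
    using chain_system_extend[OF sys R inf] l(2) unfolding good_def by blast
  obtain B where B: "P \<union> Q \<subseteq> B" "B \<subseteq> (P \<union> Q) \<union> {z. u z = 0}" "independent B"
      "(P \<union> Q) \<union> {z. u z = 0} \<subseteq> span B"
    using maximal_independent_subset_extend[of "P \<union> Q" "(P \<union> Q) \<union> {z. u z = 0}"] indep by blast
  have "v \<in> span B" for v
  proof -
    obtain b where b: "b \<in> span (P \<union> Q)" "u v = u b"
      using sys range[of v] by (auto simp: chain_system_def)
    then have "v - b \<in> span B"
      using B(4) by (auto simp: endo_diff lin_u)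
    moreover have "b \<in> span B" using b B(1) span_mono by blast
    ultimately show ?thesis by (metis diff_add_cancel span_add)
  qed
  then have span: "span B = UNIV" by auto
  define Q' where "Q' = Q \<union> (B - (P \<union> Q))"
  have PQ': "P \<union> Q' = B" using B(1) by (auto simp: Q'_def)
  have "parity_basis scale u P Q' l e y"
  proof unfold_locales
    show "u x \<in> span P" if "x \<in> Q'" for x
      using that u_Q B(2) by (auto simp: Q'_def span_zero)
    show "u x \<in> span Q'" if "x \<in> P" "x \<notin> e ` {..<l}" for x
      using u_P[OF that] span_mono[of Q Q'] by (auto simp: Q'_def)
    show "u (e i) \<in> span (e ` {..i} \<union> (P - e ` {..<l}) \<union> Q')" if "i < l" for i
      using u_e[OF that] span_mono[of "e ` {..i} \<union> (P - e ` {..<l}) \<union> Q" "e ` {..i} \<union> (P - e ` {..<l}) \<union> Q'"]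
      by (auto simp: Q'_def)
    show "P \<inter> Q' = {}" using disjoint by (auto simp: Q'_def)
  qed (use lin_u inj_e e_in y_in u_y B(3) PQ' in \<open>auto simp: Q'_def\<close>)
  then show thesis using that span unfolding PQ'[symmetric] by blast
qed

end

theorem corollary6p2:
  fixes scale :: "'a::field \<Rightarrow> 'b::ab_group_add \<Rightarrow> 'b"
    and u :: "'b \<Rightarrow> 'b"
    and \<alpha> :: 'a
  assumes "vector_space scale"
    and "infinite_dimensional scale"
    and "endomorphism scale u"
    and "finite_rank scale u"
  shows "\<exists>l1 l2 l3 p1 p2 p3.
    idempotent_endomorphism scale p1 \<and>
    idempotent_endomorphism scale p2 \<and>
    idempotent_endomorphism scale p3 \<and>
    (\<lambda>x. scale \<alpha> x + u x) =
      (\<lambda>x. scale l1 (p1 x) + scale l2 (p2 x) + scale l3 (p3 x))"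
proof -
  interpret endomorphism_space scale
    using assms(1) by (simp add: endomorphism_space_def)
  obtain l P Q e y where "parity_basis scale u P Q l e y" and span: "span (P \<union> Q) = UNIV"
    by (rule parity_basis_exists[OF assms(3,4,2)])
  then interpret parity_basis scale u P Q l e y by simp
  \<comment> \<open>The first coefficient can be prescribed. The choice \<open>- \<alpha>\<close> absorbs the scalar, because
    \<open>\<alpha> id - \<alpha> p = \<alpha> (id - p)\<close>.\<close>
  define a where "a = (if \<alpha> = 0 then 1 else - \<alpha>)"
  have "a \<noteq> 0" by (simp add: a_def)
  then obtain b c where "three_idempotents a b c u"
    using some_coefficients[OF span] by blast
  then obtain p q r where pqr: "idempotent_endomorphism scale p" "idempotent_endomorphism scale q"
      "idempotent_endomorphism scale r" "\<And>x. u x = scale a (p x) + scale b (q x) + scale c (r x)"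
    unfolding three_idempotents_def by blast
  show ?thesis
  proof (cases "\<alpha> = 0")
    case True
    show ?thesis
      by (intro exI[of _ a] exI[of _ b] exI[of _ c] exI[of _ p] exI[of _ q] exI[of _ r])
        (use pqr True in auto)
  next
    case False
    have p: "endo p" "\<And>x. p (p x) = p x"
      using pqr(1) by (auto simp: idempotent_endomorphism_def fun_eq_iff)
    have "idempotent_endomorphism scale (\<lambda>x. x - p x)"
      by (intro idempotent_endomorphismI endoI) (use p in \<open>simp_all add: endo_simps algebra_simps\<close>)
    then show ?thesis
      by (intro exI[of _ \<alpha>] exI[of _ b] exI[of _ c] exI[of _ "\<lambda>x. x - p x"] exI[of _ q] exI[of _ r])
        (use pqr False in \<open>auto simp: a_def algebra_simps\<close>)
  qed
qed

end
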